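(* Let $\mathcal{C}$ be a curve arrangement in which the distinguished curve $\gamma_0$ meets every other component in exactly one ordinary double point, and suppose no two components of $\mathcal{C}'=\mathcal{C}\setminus\{\gamma_0\}$ intersect each other. Let $v_0$ be the number of components of $\mathcal{C}'$. Then there exists a short exact sequence of graded vector spaces $$0\longrightarrow OS(\mathcal{C}'')\otimes\mathbb{C}[-1]\xrightarrow{\ \iota\ }OS(\mathcal{C})\xrightarrow{\ \pi\ }OS(\mathcal{C}')\longrightarrow0,$$ where $\pi$ is the projection induced by sending $e_0$ to zero, and $\iota$ is the linear map defined on the exterior basis by $$\iota(f_{j_1}\wedge\dots\wedge f_{j_p}):=e_0\wedge e_{j_1}\wedge\dots\wedge e_{j_p},$$ the generator $f_j$ of $OS(\mathcal{C}'')$ being the one corresponding to the point $\gamma_0\cap\gamma_j$ (with the ordering induced by the components $\gamma_j$ of $\mathcal{C}'$).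
   Context: $\mathcal{C}=\{\gamma_0,\gamma_1,\dots,\gamma_{v_0}\}$ is a finite set of distinct irreducible algebraic curves in the affine plane; intersections are considered in the affine plane. A node is a point lying on at least two curves; an ordinary double point is a transverse intersection of exactly two curves. $E=\bigwedge_{\mathbb{C}}\langle e_0,\dots,e_{v_0}\rangle$ has one degree-one generator per curve, and $E'=\bigwedge_{\mathbb{C}}\langle e_1,\dots,e_{v_0}\rangle$. The Koszul derivative $\partial$ is the linear map of degree $-1$ with $\partial(1)=0$, $\partial(e_i)=1$ and $\partial(\alpha\wedge\beta)=\partial(\alpha)\wedge\beta+(-1)^p\alpha\wedge\partial(\beta)$ for $\alpha$ of degree $p$. $OS(\mathcal{C})=E/I$, where $I$ is the two-sided ideal generated by the elements $\partial(e_{i_1}\wedge\dots\wedge e_{i_k})$, one for each node lying on $k\ge3$ curves, $\gamma_{i_1},\dots,\gamma_{i_k}$ being all curves through it; $OS(\mathcal{C}')=E'/I'$ is defined in the same way from $\mathcal{C}'$. $\mathcal{C}''$ is the restricted arrangement of the points $\gamma_0\cap\gamma_j$ ($j=1,\dots,v_0$) on $\gamma_0$, and $OS(\mathcal{C}'')=\bigwedge_{\mathbb{C}}\langle f_1,\dots,f_{v_0}\rangle$ is the free exterior algebra on one generator per point. $\otimes\,\mathbb{C}[-1]$ is the shift placing the degree-$p$ part in degree $p+1$. *)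

theory Defs
  imports "HOL-Algebra.Algebra" "HOL-Algebra.Algebraic_Closure_Type"
begin

section \<open>Curve arrangements in the complex affine plane\<close>

text \<open>
  A polynomial in \<open>\<complex>[x,y]\<close> is an element of \<^typ>\<open>complex poly poly\<close>, read as a polynomial in \<open>y\<close>
  with coefficients in \<open>\<complex>[x]\<close>.
\<close>

definition eval2 :: "complex poly poly \<Rightarrow> complex \<times> complex \<Rightarrow> complex" where
  "eval2 p P = poly (poly p [:snd P:]) (fst P)"

definition partial_x :: "complex poly poly \<Rightarrow> complex poly poly" where
  "partial_x p = map_poly pderiv p"

definition partial_y :: "complex poly poly \<Rightarrow> complex poly poly" where
  "partial_y p = pderiv p"

definition curve :: "complex poly poly \<Rightarrow> (complex \<times> complex) set" where
  "curve p = {P. eval2 p P = 0}"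

definition curve_arrangement :: "(nat \<Rightarrow> complex poly poly) \<Rightarrow> nat set \<Rightarrow> bool" where
  "curve_arrangement \<gamma> A \<longleftrightarrow>
     finite A \<and> (\<forall>i\<in>A. Factorial_Ring.irreducible (\<gamma> i)) \<and> inj_on (\<lambda>i. curve (\<gamma> i)) A"

definition smooth_at :: "complex poly poly \<Rightarrow> complex \<times> complex \<Rightarrow> bool" where
  "smooth_at p P \<longleftrightarrow> P \<in> curve p \<and> (eval2 (partial_x p) P, eval2 (partial_y p) P) \<noteq> (0, 0)"

definition tangent_space ::
  "complex poly poly \<Rightarrow> complex \<times> complex \<Rightarrow> (complex \<times> complex) set" where
  "tangent_space p P =
     {(u, v). eval2 (partial_x p) P * u + eval2 (partial_y p) P * v = 0}"

definition transverse_at ::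
  "complex poly poly \<Rightarrow> complex poly poly \<Rightarrow> complex \<times> complex \<Rightarrow> bool" where
  "transverse_at p q P \<longleftrightarrow>
     smooth_at p P \<and> smooth_at q P \<and> tangent_space p P \<noteq> tangent_space q P"

definition curves_through ::
  "(nat \<Rightarrow> complex poly poly) \<Rightarrow> nat set \<Rightarrow> complex \<times> complex \<Rightarrow> nat set" where
  "curves_through \<gamma> A P = {i \<in> A. P \<in> curve (\<gamma> i)}"

definition nodes :: "(nat \<Rightarrow> complex poly poly) \<Rightarrow> nat set \<Rightarrow> (complex \<times> complex) set" where
  "nodes \<gamma> A = {P. card (curves_through \<gamma> A P) \<ge> 2}"

definition ordinary_double_point ::
  "(nat \<Rightarrow> complex poly poly) \<Rightarrow> nat set \<Rightarrow> complex \<times> complex \<Rightarrow> bool" where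
  "ordinary_double_point \<gamma> A P \<longleftrightarrow>
     (\<exists>i j. i \<noteq> j \<and> curves_through \<gamma> A P = {i, j} \<and> transverse_at (\<gamma> i) (\<gamma> j) P)"


section \<open>The exterior algebra on generators indexed by a set of natural numbers\<close>

text \<open>
  The function \<open>a :: nat set \<Rightarrow> complex\<close> stands for \<open>\<Sum>S. a S \<cdot> e\<^sub>S\<close>, where
  \<open>e\<^sub>S = e\<^bsub>i\<^sub>1\<^esub> \<and> \<dots> \<and> e\<^bsub>i\<^sub>k\<^esub>\<close> for \<open>S = {i\<^sub>1 < \<dots> < i\<^sub>k}\<close>.  For disjoint \<open>S\<close>, \<open>T\<close> one has
  \<open>e\<^sub>S \<and> e\<^sub>T = shuffle_sign S T \<cdot> e\<^bsub>S \<union> T\<^esub>\<close>; otherwise the product is \<open>0\<close>.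
\<close>

definition shuffle_sign :: "nat set \<Rightarrow> nat set \<Rightarrow> complex" where
  "shuffle_sign S T = (-1) ^ card {(s, t). s \<in> S \<and> t \<in> T \<and> t < s}"

definition wedge :: "(nat set \<Rightarrow> complex) \<Rightarrow> (nat set \<Rightarrow> complex) \<Rightarrow> nat set \<Rightarrow> complex" where
  "wedge a b S = (\<Sum>T\<in>Pow S. shuffle_sign T (S - T) * a T * b (S - T))"

definition basis_elt :: "nat set \<Rightarrow> nat set \<Rightarrow> complex" where
  "basis_elt S = (\<lambda>T. if T = S then 1 else 0)"

definition exterior :: "nat set \<Rightarrow> (complex, nat set \<Rightarrow> complex) module" where
  "exterior A = \<lparr>
     carrier = {a. finite {S. a S \<noteq> 0} \<and> (\<forall>S. a S \<noteq> 0 \<longrightarrow> finite S \<and> S \<subseteq> A)},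
     monoid.mult = wedge,
     one = basis_elt {},
     ring.zero = (\<lambda>S. 0),
     add = (\<lambda>a b S. a S + b S),
     module.smult = (\<lambda>c a S. c * a S)\<rparr>"

definition gen :: "nat \<Rightarrow> nat set \<Rightarrow> complex" where
  "gen i = basis_elt {i}"

definition monomial :: "nat list \<Rightarrow> nat set \<Rightarrow> complex" where
  "monomial is = foldr wedge (map gen is) (basis_elt {})"

definition exterior_degree :: "nat set \<Rightarrow> nat \<Rightarrow> (nat set \<Rightarrow> complex) set" where
  "exterior_degree A p = {a \<in> carrier (exterior A). \<forall>S. a S \<noteq> 0 \<longrightarrow> card S = p}"

text \<open>
  For finite \<open>A\<close>, the linear extension of
  \<open>\<partial> (e\<^bsub>i\<^sub>1\<^esub> \<and> \<dots> \<and> e\<^bsub>i\<^sub>k\<^esub>) = \<Sum>r. (-1)\<^bsup>r-1\<^esup> e\<^bsub>i\<^sub>1\<^esub> \<and> \<dots> (omit e\<^bsub>i\<^sub>r\<^esub>) \<dots> \<and> e\<^bsub>i\<^sub>k\<^esub>\<close>.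
  The characterisation as the graded derivation with \<open>\<partial> e\<^sub>i = 1\<close> is proved below.
\<close>

definition koszul :: "nat set \<Rightarrow> (nat set \<Rightarrow> complex) \<Rightarrow> nat set \<Rightarrow> complex" where
  "koszul A a S = (\<Sum>i\<in>A - S. (-1) ^ card {j \<in> S. j < i} * a (insert i S))"


section \<open>Graded vector spaces\<close>

abbreviation complex_field :: "complex ring" where
  "complex_field \<equiv> ring_of_type_algebra"

definition linear_maps ::
  "(complex, 'a, 'm) module_scheme \<Rightarrow> (complex, 'b, 'n) module_scheme \<Rightarrow> ('a \<Rightarrow> 'b) set" where
  "linear_maps M N = {f \<in> carrier M \<rightarrow> carrier N.
     (\<forall>x\<in>carrier M. \<forall>y\<in>carrier M. f (x \<oplus>\<^bsub>M\<^esub> y) = f x \<oplus>\<^bsub>N\<^esub> f y) \<and>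
     (\<forall>c. \<forall>x\<in>carrier M. f (c \<odot>\<^bsub>M\<^esub> x) = c \<odot>\<^bsub>N\<^esub> f x)}"

definition algebra_homs ::
  "(complex, 'a, 'm) module_scheme \<Rightarrow> (complex, 'b, 'n) module_scheme \<Rightarrow> ('a \<Rightarrow> 'b) set" where
  "algebra_homs M N = ring_hom M N \<inter> linear_maps M N"

definition graded_vector_space ::
  "(complex, 'a) module \<Rightarrow> (nat \<Rightarrow> 'a set) \<Rightarrow> bool" where
  "graded_vector_space M G \<longleftrightarrow>
     Module.module complex_field M \<and>
     (\<forall>p. submodule (G p) complex_field M) \<and>
     (\<forall>x\<in>carrier M. \<exists>!g. (\<forall>p. g p \<in> G p) \<and> finite {p. g p \<noteq> \<zero>\<^bsub>M\<^esub>} \<and>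
        x = (\<Oplus>\<^bsub>M\<^esub>p\<in>{p. g p \<noteq> \<zero>\<^bsub>M\<^esub>}. g p))"

definition graded_linear_maps ::
  "(complex, 'a) module \<Rightarrow> (nat \<Rightarrow> 'a set) \<Rightarrow> (complex, 'b) module \<Rightarrow> (nat \<Rightarrow> 'b set)
    \<Rightarrow> ('a \<Rightarrow> 'b) set" where
  "graded_linear_maps M G N H = {f \<in> linear_maps M N. \<forall>p. f ` G p \<subseteq> H p}"

text \<open>The grading of \<open>M \<otimes> \<complex>[-1]\<close>, whose underlying vector space is that of \<open>M\<close>.\<close>

definition shift_grading :: "(complex, 'a) module \<Rightarrow> (nat \<Rightarrow> 'a set) \<Rightarrow> nat \<Rightarrow> 'a set" where
  "shift_grading M G p = (case p of 0 \<Rightarrow> {\<zero>\<^bsub>M\<^esub>} | Suc q \<Rightarrow> G q)"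

text \<open>
  The library's \<^const>\<open>short_exact_sequence\<close> needs all three terms to have the same element type
  and knows neither scalars nor degrees.
\<close>

definition graded_short_exact_sequence ::
  "(complex, 'a) module \<Rightarrow> (nat \<Rightarrow> 'a set) \<Rightarrow> (complex, 'b) module \<Rightarrow> (nat \<Rightarrow> 'b set) \<Rightarrow>
   (complex, 'c) module \<Rightarrow> (nat \<Rightarrow> 'c set) \<Rightarrow> ('a \<Rightarrow> 'b) \<Rightarrow> ('b \<Rightarrow> 'c) \<Rightarrow> bool" where
  "graded_short_exact_sequence L F M G N H f g \<longleftrightarrow>
     graded_vector_space L F \<and> graded_vector_space M G \<and> graded_vector_space N H \<and>
     f \<in> graded_linear_maps L F M G \<and> g \<in> graded_linear_maps M G N H \<and>
     inj_on f (carrier L) \<and> f ` carrier L = a_kernel M N g \<and> g ` carrier M = carrier N"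

definition quotient_algebra ::
  "(complex, 'a) module \<Rightarrow> 'a set \<Rightarrow> (complex, 'a set) module" where
  "quotient_algebra E I =
     ring.extend (E Quot I) (module.fields (\<lambda>c B. \<Union>x\<in>B. I +>\<^bsub>E\<^esub> (c \<odot>\<^bsub>E\<^esub> x)))"


section \<open>Orlik--Solomon algebras of curve arrangements\<close>

definition OS_ideal :: "(nat \<Rightarrow> complex poly poly) \<Rightarrow> nat set \<Rightarrow> (nat set \<Rightarrow> complex) set" where
  "OS_ideal \<gamma> A = Idl\<^bsub>exterior A\<^esub>
     {koszul A (monomial (sorted_list_of_set (curves_through \<gamma> A P))) | P.
        P \<in> nodes \<gamma> A \<and> card (curves_through \<gamma> A P) \<ge> 3}"

definition OS ::
  "(nat \<Rightarrow> complex poly poly) \<Rightarrow> nat set \<Rightarrow> (complex, (nat set \<Rightarrow> complex) set) module" where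
  "OS \<gamma> A = quotient_algebra (exterior A) (OS_ideal \<gamma> A)"

definition OS_class ::
  "(nat \<Rightarrow> complex poly poly) \<Rightarrow> nat set \<Rightarrow> (nat set \<Rightarrow> complex) \<Rightarrow> (nat set \<Rightarrow> complex) set" where
  "OS_class \<gamma> A x = OS_ideal \<gamma> A +>\<^bsub>exterior A\<^esub> x"

definition OS_degree ::
  "(nat \<Rightarrow> complex poly poly) \<Rightarrow> nat set \<Rightarrow> nat \<Rightarrow> (nat set \<Rightarrow> complex) set set" where
  "OS_degree \<gamma> A p = OS_class \<gamma> A ` exterior_degree A p"

text \<open>
  The points cut out on \<open>\<gamma> 0\<close> by the other curves.  A point is labelled (and the generators are
  thereby ordered) by the first other curve through it, so that the point
  \<open>\<gamma> 0 \<inter> \<gamma> j\<close> gives the generator \<open>f\<^sub>j\<close> when it lies on no further curve.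
\<close>

definition restricted_points ::
  "(nat \<Rightarrow> complex poly poly) \<Rightarrow> nat \<Rightarrow> (complex \<times> complex) set" where
  "restricted_points \<gamma> v = (\<Union>j\<in>{1..v}. curve (\<gamma> 0) \<inter> curve (\<gamma> j))"

definition point_label :: "(nat \<Rightarrow> complex poly poly) \<Rightarrow> nat \<Rightarrow> complex \<times> complex \<Rightarrow> nat" where
  "point_label \<gamma> v P = Min (curves_through \<gamma> {1..v} P)"

definition restricted_labels :: "(nat \<Rightarrow> complex poly poly) \<Rightarrow> nat \<Rightarrow> nat set" where
  "restricted_labels \<gamma> v = point_label \<gamma> v ` restricted_points \<gamma> v"


section \<open>The exterior algebra and the Koszul derivative are as expected\<close>

lemma shuffle_sign_mult_self [simp]: "shuffle_sign S T * shuffle_sign S T = 1"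
  by (simp add: shuffle_sign_def flip: power_mult_distrib)

lemma sign_cancel:
  fixes u x :: complex
  shows "u * u = 1 \<Longrightarrow> u * (u * x) = x"
  by (simp flip: mult.assoc)

lemma shuffle_sign_empty [simp]: "shuffle_sign {} T = 1" "shuffle_sign T {} = 1"
  by (simp_all add: shuffle_sign_def)

lemma shuffle_sign_union_left:
  assumes "finite S" "finite S'" "finite T" "S \<inter> S' = {}"
  shows "shuffle_sign (S \<union> S') T = shuffle_sign S T * shuffle_sign S' T"
proof -
  let ?P = "\<lambda>S. {(s, t). s \<in> S \<and> t \<in> T \<and> t < s}"
  have fin: "finite (?P Z)" if "finite Z" for Z
    by (rule finite_subset[of _ "Z \<times> T"]) (use that assms in auto)
  have eq: "?P (S \<union> S') = ?P S \<union> ?P S'" by auto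
  have "card (?P (S \<union> S')) = card (?P S) + card (?P S')"
    unfolding eq by (rule card_Un_disjoint) (use fin assms in auto)
  then show ?thesis by (simp add: shuffle_sign_def power_add)
qed

lemma shuffle_sign_union_right:
  assumes "finite S" "finite T" "finite T'" "T \<inter> T' = {}"
  shows "shuffle_sign S (T \<union> T') = shuffle_sign S T * shuffle_sign S T'"
proof -
  let ?P = "\<lambda>T. {(s, t). s \<in> S \<and> t \<in> T \<and> t < s}"
  have fin: "finite (?P Z)" if "finite Z" for Z
    by (rule finite_subset[of _ "S \<times> Z"]) (use that assms in auto)
  have eq: "?P (T \<union> T') = ?P T \<union> ?P T'" by auto
  have "card (?P (T \<union> T')) = card (?P T) + card (?P T')"
    unfolding eq by (rule card_Un_disjoint) (use fin assms in auto)
  then show ?thesis by (simp add: shuffle_sign_def power_add)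
qed

lemma shuffle_sign_singleton_left: "shuffle_sign {i} S = (-1) ^ card {j \<in> S. j < i}"
proof -
  have "{(s, t). s \<in> {i} \<and> t \<in> S \<and> t < s} = Pair i ` {j \<in> S. j < i}" by auto
  then show ?thesis by (simp add: shuffle_sign_def card_image inj_on_def)
qed

lemma shuffle_sign_singleton_right: "shuffle_sign S {i} = (-1) ^ card {j \<in> S. i < j}"
proof -
  have "{(s, t). s \<in> S \<and> t \<in> {i} \<and> t < s} = (\<lambda>j. (j, i)) ` {j \<in> S. i < j}" by auto
  then show ?thesis by (simp add: shuffle_sign_def card_image inj_on_def)
qed

lemma shuffle_sign_swap:
  assumes "finite S" "i \<notin> S"
  shows "shuffle_sign {i} S * shuffle_sign S {i} = (-1) ^ card S"
proof -
  have "card ({j \<in> S. j < i} \<union> {j \<in> S. i < j}) = card {j \<in> S. j < i} + card {j \<in> S. i < j}"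
    by (rule card_Un_disjoint) (use assms(1) in \<open>simp_all add: disjoint_iff\<close>)
  moreover have "{j \<in> S. j < i} \<union> {j \<in> S. i < j} = S"
    using assms by (auto simp: neq_iff) (metis linorder_cases)
  ultimately have "card S = card {j \<in> S. j < i} + card {j \<in> S. i < j}"
    by simp
  then show ?thesis
    by (simp add: shuffle_sign_singleton_left shuffle_sign_singleton_right power_add)
qed

lemma koszul_shuffle: "koszul A a S = (\<Sum>i\<in>A - S. shuffle_sign {i} S * a (insert i S))"
  by (simp add: koszul_def shuffle_sign_singleton_left)

lemma wedge_infinite: "infinite S \<Longrightarrow> wedge a b S = 0"
  by (simp add: wedge_def)

lemma wedge_assoc: "wedge (wedge a b) c = wedge a (wedge b c)"
proof
  fix S
  show "wedge (wedge a b) c S = wedge a (wedge b c) S"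
  proof (cases "finite S")
    case fin: True
    let ?s = shuffle_sign
    have "wedge (wedge a b) c S =
      (\<Sum>(T, R)\<in>(SIGMA T:Pow S. Pow T). ?s T (S - T) * (?s R (T - R) * a R * b (T - R)) * c (S - T))"
      unfolding wedge_def sum_distrib_left sum_distrib_right
      by (subst sum.Sigma) (use fin in \<open>auto intro: finite_subset\<close>)
    also have "\<dots> = (\<Sum>(R, Q)\<in>(SIGMA R:Pow S. Pow (S - R)).
        ?s R (S - R) * a R * (?s Q (S - R - Q) * b Q * c (S - R - Q)))"
    proof (rule sum.reindex_bij_witness[where
        i = "\<lambda>(R, Q). (R \<union> Q, R)" and j = "\<lambda>(T, R). (R, T - R)"], goal_cases)
      case (5 x)
      obtain T R where x: "x = (T, R)" by (cases x)
      with 5 have TR: "T \<subseteq> S" "R \<subseteq> T" by auto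
      define Q U where "Q = T - R" and "U = S - T"
      have f: "finite R" "finite Q" "finite U"
        using TR fin by (auto simp: Q_def U_def intro: finite_subset)
      have e: "T = R \<union> Q" "S - R = Q \<union> U" "S - R - Q = U" "R \<inter> Q = {}" "Q \<inter> U = {}"
        using TR by (auto simp: Q_def U_def)
      have "?s T U = ?s R U * ?s Q U"
        unfolding e(1) by (rule shuffle_sign_union_left) (use f e in auto)
      moreover have "?s R (S - R) = ?s R Q * ?s R U"
        unfolding e(2) by (rule shuffle_sign_union_right) (use f e in auto)
      ultimately show ?case
        by (simp add: x e(3) flip: Q_def U_def)
    qed auto
    also have "\<dots> = wedge a (wedge b c) S"
      unfolding wedge_def sum_distrib_left sum_distrib_right
      by (subst sum.Sigma) (use fin in \<open>auto intro: finite_subset\<close>)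
    finally show ?thesis .
  qed (simp add: wedge_infinite)
qed

lemma exterior_simps [simp]:
  "monoid.mult (exterior A) = wedge"
  "one (exterior A) = basis_elt {}"
  "ring.zero (exterior A) = (\<lambda>S. 0)"
  "add (exterior A) = (\<lambda>a b S. a S + b S)"
  "module.smult (exterior A) = (\<lambda>c a S. c * a S)"
  by (simp_all add: exterior_def)

lemma exterior_carrier:
  "a \<in> carrier (exterior A) \<longleftrightarrow> finite {S. a S \<noteq> 0} \<and> (\<forall>S. a S \<noteq> 0 \<longrightarrow> finite S \<and> S \<subseteq> A)"
  by (simp add: exterior_def)

lemma exterior_carrier_finite:
  assumes "finite A"
  shows "a \<in> carrier (exterior A) \<longleftrightarrow> (\<forall>S. a S \<noteq> 0 \<longrightarrow> S \<subseteq> A)"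
proof -
  have "finite {S. a S \<noteq> 0}" if "\<forall>S. a S \<noteq> 0 \<longrightarrow> S \<subseteq> A"
    by (rule finite_subset[of _ "Pow A"]) (use that assms in auto)
  then show ?thesis using assms by (auto simp: exterior_carrier intro: finite_subset)
qed

lemma wedge_nonzeroE:
  assumes "wedge a b S \<noteq> 0"
  obtains T U where "S = T \<union> U" "T \<inter> U = {}" "a T \<noteq> 0" "b U \<noteq> 0"
proof -
  obtain T where T: "T \<in> Pow S" "shuffle_sign T (S - T) * a T * b (S - T) \<noteq> 0"
    using assms unfolding wedge_def by (rule sum.not_neutral_contains_not_neutral)
  show ?thesis by (rule that[of T "S - T"]) (use T in auto)
qed

lemma wedge_closed:
  assumes "a \<in> carrier (exterior A)" "b \<in> carrier (exterior A)"
  shows "wedge a b \<in> carrier (exterior A)"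
proof -
  have "finite ((\<lambda>(T, U). T \<union> U) ` ({T. a T \<noteq> 0} \<times> {U. b U \<noteq> 0}))"
    using assms by (auto simp: exterior_carrier)
  moreover have "{S. wedge a b S \<noteq> 0} \<subseteq> (\<lambda>(T, U). T \<union> U) ` ({T. a T \<noteq> 0} \<times> {U. b U \<noteq> 0})"
    by (auto elim!: wedge_nonzeroE)
  ultimately have "finite {S. wedge a b S \<noteq> 0}" by (rule finite_subset[rotated])
  with assms show ?thesis by (auto simp: exterior_carrier elim!: wedge_nonzeroE)
qed

lemma wedge_one_left: "a \<in> carrier (exterior A) \<Longrightarrow> wedge (basis_elt {}) a = a"
proof
  fix S assume a: "a \<in> carrier (exterior A)"
  show "wedge (basis_elt {}) a S = a S"
  proof (cases "finite S")
    case True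
    have "wedge (basis_elt {}) a S = (\<Sum>T\<in>{{}}. shuffle_sign T (S - T) * basis_elt {} T * a (S - T))"
      unfolding wedge_def by (rule sum.mono_neutral_right) (use True in \<open>auto simp: basis_elt_def\<close>)
    then show ?thesis by (simp add: basis_elt_def)
  qed (use a in \<open>auto simp: wedge_infinite exterior_carrier\<close>)
qed

lemma wedge_one_right: "a \<in> carrier (exterior A) \<Longrightarrow> wedge a (basis_elt {}) = a"
proof
  fix S assume a: "a \<in> carrier (exterior A)"
  show "wedge a (basis_elt {}) S = a S"
  proof (cases "finite S")
    case True
    have "wedge a (basis_elt {}) S = (\<Sum>T\<in>{S}. shuffle_sign T (S - T) * a T * basis_elt {} (S - T))"
      unfolding wedge_def by (rule sum.mono_neutral_right) (use True in \<open>auto simp: basis_elt_def\<close>)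
    then show ?thesis by (simp add: basis_elt_def)
  qed (use a in \<open>auto simp: wedge_infinite exterior_carrier\<close>)
qed

lemma exterior_add_closed:
  assumes "a \<in> carrier (exterior A)" "b \<in> carrier (exterior A)"
  shows "(\<lambda>S. a S + b S) \<in> carrier (exterior A)"
proof -
  have "finite ({S. a S \<noteq> 0} \<union> {S. b S \<noteq> 0})" using assms by (auto simp: exterior_carrier)
  then have "finite {S. a S + b S \<noteq> 0}" by (rule finite_subset[rotated]) auto
  moreover have "finite S \<and> S \<subseteq> A" if "a S + b S \<noteq> 0" for S
    using that assms unfolding exterior_carrier by (metis add_0)
  ultimately show ?thesis unfolding exterior_carrier by blast
qed

lemma exterior_smult_closed:
  assumes "a \<in> carrier (exterior A)"
  shows "(\<lambda>S. c * a S) \<in> carrier (exterior A)"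
proof -
  have "finite {S. c * a S \<noteq> 0}"
    by (rule finite_subset[of _ "{S. a S \<noteq> 0}"]) (use assms in \<open>auto simp: exterior_carrier\<close>)
  with assms show ?thesis by (auto simp: exterior_carrier)
qed

lemma basis_elt_closed: "finite S \<Longrightarrow> S \<subseteq> A \<Longrightarrow> basis_elt S \<in> carrier (exterior A)"
  by (auto simp: exterior_carrier basis_elt_def)

lemma exterior_abelian_group: "abelian_group (exterior A)"
proof (rule abelian_groupI, goal_cases)
  case (6 a)
  show ?case
    by (rule bexI[of _ "\<lambda>S. -1 * a S"]) (use exterior_smult_closed[OF 6, of "-1"] in auto)
qed (auto simp: exterior_add_closed add_ac, auto simp: exterior_carrier)

lemma exterior_ring: "ring (exterior A)"
proof (rule ringI)
  show "abelian_group (exterior A)" by (rule exterior_abelian_group)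
  show "Group.monoid (exterior A)"
    by (rule monoidI) (auto simp: wedge_closed wedge_assoc wedge_one_left wedge_one_right basis_elt_closed)
qed (auto simp: wedge_def fun_eq_iff algebra_simps sum.distrib)

lemma exterior_module: "Module.module complex_field (exterior A)"
  by (rule moduleI)
     (auto simp: exterior_abelian_group exterior_smult_closed algebra_simps ring_of_type_algebra_def[symmetric]
        intro: cring_from_type_algebra, auto simp: ring_of_type_algebra_def algebra_simps)

lemma wedge_basis_elt:
  assumes "finite S" "finite T"
  shows "wedge (basis_elt S) (basis_elt T) =
    (if S \<inter> T = {} then (\<lambda>U. shuffle_sign S T * basis_elt (S \<union> T) U) else (\<lambda>U. 0))"
proof
  fix U
  show "wedge (basis_elt S) (basis_elt T) U =
    (if S \<inter> T = {} then (\<lambda>U. shuffle_sign S T * basis_elt (S \<union> T) U) else (\<lambda>U. 0)) U"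
  proof (cases "U = S \<union> T \<and> S \<inter> T = {}")
    case True
    then have "wedge (basis_elt S) (basis_elt T) U =
        (\<Sum>R\<in>{S}. shuffle_sign R (U - R) * basis_elt S R * basis_elt T (U - R))"
      unfolding wedge_def by (intro sum.mono_neutral_right) (use assms in \<open>auto simp: basis_elt_def\<close>)
    moreover from True have "U - S = T" by auto
    ultimately show ?thesis using True by (simp add: basis_elt_def)
  next
    case False
    have "wedge (basis_elt S) (basis_elt T) U = 0"
    proof (rule ccontr)
      assume "wedge (basis_elt S) (basis_elt T) U \<noteq> 0"
      then show False using False by (elim wedge_nonzeroE) (auto simp: basis_elt_def split: if_splits)
    qed
    then show ?thesis using False by (auto simp: basis_elt_def)
  qed
qed

lemma wedge_gen_self: "wedge (gen i) (gen i) = (\<lambda>S. 0)"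
  by (simp add: gen_def wedge_basis_elt)

lemma wedge_gen_anticommute: "wedge (gen i) (gen j) = (\<lambda>S. - wedge (gen j) (gen i) S)"
  by (cases i j rule: linorder_cases)
     (simp_all add: gen_def wedge_basis_elt shuffle_sign_singleton_left fun_eq_iff insert_commute
      Collect_conv_if)

lemma monomial_sorted:
  "sorted_wrt (<) is \<Longrightarrow> monomial is = basis_elt (set is)"
proof (induction "is")
  case (Cons i "is")
  have "{j \<in> set is. j < i} = {}" using Cons.prems by auto
  then have "shuffle_sign {i} (set is) = 1"
    by (simp only: shuffle_sign_singleton_left) simp
  moreover have "monomial (i # is) = wedge (basis_elt {i}) (basis_elt (set is))"
    using Cons by (simp add: monomial_def gen_def)
  moreover have "i \<notin> set is" using Cons.prems by auto
  ultimately show ?case by (simp add: wedge_basis_elt)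
qed (simp add: monomial_def)

lemma koszul_linear:
  "koszul A (\<lambda>S. a S + b S) = (\<lambda>S. koszul A a S + koszul A b S)"
  "koszul A (\<lambda>S. c * a S) = (\<lambda>S. c * koszul A a S)"
  by (auto simp: koszul_def fun_eq_iff algebra_simps sum.distrib sum_distrib_left)

lemma koszul_nonzeroE:
  assumes "koszul A a S \<noteq> 0"
  obtains i where "i \<in> A" "i \<notin> S" "a (insert i S) \<noteq> 0"
proof -
  obtain i where i: "i \<in> A - S" "(-1) ^ card {j \<in> S. j < i} * a (insert i S) \<noteq> 0"
    using assms unfolding koszul_def by (rule sum.not_neutral_contains_not_neutral)
  show ?thesis by (rule that[of i]) (use i in auto)
qed

lemma koszul_closed:
  "finite A \<Longrightarrow> a \<in> carrier (exterior A) \<Longrightarrow> koszul A a \<in> carrier (exterior A)"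
  by (auto simp: exterior_carrier_finite elim!: koszul_nonzeroE)

lemma koszul_degree:
  assumes "finite A" "a \<in> exterior_degree A (Suc p)"
  shows "koszul A a \<in> exterior_degree A p"
proof -
  have "card S = p" if nz: "koszul A a S \<noteq> 0" for S
  proof -
    obtain i where i: "i \<in> A" "i \<notin> S" "a (insert i S) \<noteq> 0"
      using nz by (rule koszul_nonzeroE)
    then have "insert i S \<subseteq> A" "card (insert i S) = Suc p"
      using assms by (auto simp: exterior_degree_def exterior_carrier)
    with i assms(1) show ?thesis by (metis card_insert_disjoint diff_Suc_1 finite_insert finite_subset)
  qed
  with assms show ?thesis by (auto simp: exterior_degree_def koszul_closed)
qed

lemma koszul_one: "koszul A (basis_elt {}) = (\<lambda>S. 0)"
  by (auto simp: koszul_def basis_elt_def)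

lemma koszul_gen:
  assumes "finite A" "i \<in> A"
  shows "koszul A (gen i) = basis_elt {}"
proof
  fix S
  show "koszul A (gen i) S = basis_elt {} S"
  proof (cases "S = {}")
    case True
    have "koszul A (gen i) S = (\<Sum>j\<in>{i}. (-1) ^ card {k \<in> S. k < j} * gen i (insert j S))"
      unfolding koszul_def
      by (rule sum.mono_neutral_right) (use assms True in \<open>auto simp: gen_def basis_elt_def\<close>)
    then show ?thesis using True by (simp add: gen_def basis_elt_def)
  next
    case False
    then have "koszul A (gen i) S = 0"
      unfolding koszul_def by (intro sum.neutral) (auto simp: gen_def basis_elt_def)
    then show ?thesis using False by (simp add: basis_elt_def)
  qed
qed

lemma sum_Pow_insert:
  assumes "finite S" "i \<notin> S"
  shows "(\<Sum>T\<in>Pow (insert i S). f T) = (\<Sum>T\<in>Pow S. f T) + (\<Sum>T\<in>Pow S. f (insert i T))"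
proof -
  have "inj_on (insert i) (Pow S)" using assms by (auto simp: inj_on_def)
  moreover have "Pow S \<inter> insert i ` Pow S = {}" using assms by auto
  ultimately show ?thesis
    using assms by (simp add: Pow_insert sum.union_disjoint sum.reindex)
qed

lemma koszul_leibniz:
  assumes A: "finite A" and a: "a \<in> exterior_degree A p" and b: "b \<in> carrier (exterior A)"
  shows "koszul A (wedge a b) =
    (\<lambda>S. wedge (koszul A a) b S + (-1) ^ p * wedge a (koszul A b) S)"
proof
  fix S
  let ?s = shuffle_sign
  have acar: "a \<in> carrier (exterior A)" and adeg: "\<And>T. a T \<noteq> 0 \<Longrightarrow> card T = p"
    using a by (auto simp: exterior_degree_def)
  show "koszul A (wedge a b) S = wedge (koszul A a) b S + (-1) ^ p * wedge a (koszul A b) S"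
  proof (cases "S \<subseteq> A")
    case False
    note c = wedge_closed koszul_closed A acar b
    have z: "x S = 0" if "x \<in> carrier (exterior A)" for x
      using that False by (auto simp: exterior_carrier)
    show ?thesis
      by (simp add: z[OF koszul_closed[OF A wedge_closed[OF acar b]]]
          z[OF wedge_closed[OF koszul_closed[OF A acar] b]]
          z[OF wedge_closed[OF acar koszul_closed[OF A b]]])
  next
    case SA: True
    then have fS: "finite S" using A by (rule finite_subset)
    have fT: "finite T" if "T \<subseteq> S" for T using that fS by (rule finite_subset)
    define F where "F T i = (-1) ^ p * (?s T (S - T) * a T * (?s {i} (S - T) * b (insert i (S - T))))" for T i
    define G where "G T i = ?s T (S - T) * (?s {i} T * a (insert i T)) * b (S - T)" for T i
    have 1: "koszul A (wedge a b) S = (\<Sum>i\<in>A - S. (\<Sum>T\<in>Pow S. F T i) + (\<Sum>T\<in>Pow S. G T i))"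
      unfolding koszul_shuffle
    proof (rule sum.cong[OF refl])
      fix i assume i: "i \<in> A - S"
      have "?s {i} S * (?s T (insert i S - T) * a T * b (insert i S - T)) = F T i" if "T \<in> Pow S" for T
      proof (cases "a T = 0")
        case False
        then have cT: "card T = p" by (rule adeg)
        from that have T: "T \<subseteq> S" by simp
        have e: "insert i S - T = (S - T) \<union> {i}" "S = T \<union> (S - T)" using T i by auto
        have "?s {i} S = ?s {i} T * ?s {i} (S - T)"
          by (subst e(2), rule shuffle_sign_union_right) (use T fT fS in auto)
        moreover have "?s T (insert i S - T) = ?s T (S - T) * ?s T {i}"
          unfolding e(1) by (rule shuffle_sign_union_right) (use T fT fS i in auto)
        moreover have "?s {i} T * ?s T {i} = (-1) ^ p"
          using shuffle_sign_swap[of T i] T fT i cT by auto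
        moreover have "insert i (S - T) = insert i S - T" using T i by auto
        ultimately show ?thesis unfolding F_def by (simp add: algebra_simps)
      qed (simp add: F_def)
      moreover have "?s {i} S * (?s (insert i T) (insert i S - insert i T) * a (insert i T) *
          b (insert i S - insert i T)) = G T i" if "T \<in> Pow S" for T
      proof -
        from that have T: "T \<subseteq> S" by simp
        have e: "insert i S - insert i T = S - T" "S = T \<union> (S - T)" "insert i T = {i} \<union> T"
          using T i by auto
        have "?s {i} S = ?s {i} T * ?s {i} (S - T)"
          by (subst e(2), rule shuffle_sign_union_right) (use T fT fS in auto)
        moreover have "?s (insert i T) (S - T) = ?s {i} (S - T) * ?s T (S - T)"
          unfolding e(3) by (rule shuffle_sign_union_left) (use T fT fS i in auto)
        moreover have "?s {i} (S - T) * ?s {i} (S - T) = 1" by simp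
        ultimately show ?thesis unfolding G_def e(1) by (simp add: mult.assoc mult.left_commute sign_cancel)
      qed
      ultimately show "?s {i} S * wedge a b (insert i S) = (\<Sum>T\<in>Pow S. F T i) + (\<Sum>T\<in>Pow S. G T i)"
        using i fS by (simp add: wedge_def sum_Pow_insert sum_distrib_left distrib_left)
    qed
    have 2: "wedge (koszul A a) b S = (\<Sum>T\<in>Pow S. \<Sum>i\<in>A - S. G T i) + (\<Sum>T\<in>Pow S. \<Sum>i\<in>S - T. G T i)"
      unfolding wedge_def koszul_shuffle sum.distrib[symmetric]
    proof (rule sum.cong[OF refl])
      fix T assume "T \<in> Pow S"
      then have "A - T = (A - S) \<union> (S - T)" using SA by auto
      then have "(\<Sum>i\<in>A - T. G T i) = (\<Sum>i\<in>A - S. G T i) + (\<Sum>i\<in>S - T. G T i)"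
        using A fS by (simp add: sum.union_disjoint Int_Diff disjoint_iff)
      then show "?s T (S - T) * (\<Sum>i\<in>A - T. ?s {i} T * a (insert i T)) * b (S - T) =
          (\<Sum>i\<in>A - S. G T i) + (\<Sum>i\<in>S - T. G T i)"
        by (simp add: G_def sum_distrib_left sum_distrib_right)
    qed
    have 3: "(-1) ^ p * wedge a (koszul A b) S =
        (\<Sum>T\<in>Pow S. \<Sum>i\<in>A - S. F T i) + (\<Sum>T\<in>Pow S. \<Sum>i\<in>T. F T i)"
      unfolding wedge_def koszul_shuffle sum.distrib[symmetric] sum_distrib_left[of "(-1) ^ p"]
    proof (rule sum.cong[OF refl])
      fix T assume T: "T \<in> Pow S"
      then have "A - (S - T) = (A - S) \<union> T" using SA by auto
      moreover have "(A - S) \<inter> T = {}" using T by auto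
      ultimately have "(\<Sum>i\<in>A - (S - T). F T i) = (\<Sum>i\<in>A - S. F T i) + (\<Sum>i\<in>T. F T i)"
        using A fT T by (simp add: sum.union_disjoint)
      then show "(-1) ^ p * (?s T (S - T) * a T * (\<Sum>i\<in>A - (S - T). ?s {i} (S - T) * b (insert i (S - T)))) =
          (\<Sum>i\<in>A - S. F T i) + (\<Sum>i\<in>T. F T i)"
        by (simp add: F_def sum_distrib_left)
    qed
    have 4: "(\<Sum>T\<in>Pow S. \<Sum>i\<in>T. F T i) = - (\<Sum>T\<in>Pow S. \<Sum>i\<in>S - T. G T i)"
    proof -
      have "(\<Sum>(T, i)\<in>(SIGMA T:Pow S. T). F T i) = (\<Sum>(T, i)\<in>(SIGMA T:Pow S. S - T). - G T i)"
      proof (rule sum.reindex_bij_witness[where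
          i = "\<lambda>(T, i). (insert i T, i)" and j = "\<lambda>(T, i). (T - {i}, i)"], goal_cases)
        case (5 x)
        obtain T' i where x: "x = (T', i)" by (cases x)
        define T where "T = T' - {i}"
        from 5 x have T': "T' = insert i T" "i \<notin> T" "T \<subseteq> S" "i \<in> S" by (auto simp: T_def)
        have "F T' i = - G T i"
        proof (cases "a T' = 0")
          case True
          then show ?thesis using T' by (simp add: F_def G_def)
        next
          case False
          then have p: "p = Suc (card T)" using adeg[OF False] T' fT by simp
          define U where "U = S - T'"
          have e: "insert i (S - T') = S - T" "S - T = U \<union> {i}" "T' = {i} \<union> T"
            using T' by (auto simp: U_def)
          have "?s T' U = ?s {i} U * ?s T U"
            unfolding e(3) by (rule shuffle_sign_union_left) (use T' fT fS in \<open>auto simp: U_def\<close>)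
          moreover have "?s T (S - T) = ?s T U * ?s T {i}"
            unfolding e(2) by (rule shuffle_sign_union_right) (use T' fT fS in \<open>auto simp: U_def\<close>)
          moreover have "(-1) ^ card T = ?s T {i} * ?s {i} T"
            using shuffle_sign_swap[of T i] T' fT by (simp add: mult.commute)
          moreover have "(-1 :: complex) ^ p = - ((-1) ^ card T)" by (simp add: p)
          moreover have "F T' i = (-1) ^ p * (?s T' U * a T' * (?s {i} U * b (S - T)))"
            unfolding F_def U_def e(1) ..
          moreover have "G T i = ?s T (S - T) * (?s {i} T * a T') * b (S - T)"
            unfolding G_def T'(1) ..
          ultimately show ?thesis by (simp add: mult_ac sign_cancel)
        qed
        then show ?case by (simp add: x T_def)
      qed auto
      then show ?thesis
        using fS fT by (simp add: sum.Sigma sum_negf[symmetric] split_def)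
    qed
    show ?thesis unfolding 1 2 3 4 by (simp add: sum.distrib sum.swap[of _ "A - S"])
  qed
qed

end

theory Submission
  imports Defs
begin

text \<open>
  The hypotheses leave no room for a relation.  A node on three or more curves lies on two curves
  other than \<open>\<gamma>\<^sub>0\<close>, and these do not meet; so both Orlik--Solomon ideals are generated by the empty
  set, and both Orlik--Solomon algebras are the exterior algebras themselves, up to the isomorphism
  \<open>x \<mapsto> {0} + x\<close> (\<open>OS_class_linear_iso\<close>).  For the same reason the points \<open>\<gamma>\<^sub>0 \<inter> \<gamma>\<^sub>j\<close> are
  pairwise distinct, and the label of \<open>\<gamma>\<^sub>0 \<inter> \<gamma>\<^sub>j\<close> is \<open>j\<close>.

  What remains is a statement about exterior algebras (\<open>exterior_deletion_sequence\<close>): splitting the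
  monomials on \<open>insert i B\<close> into those with and those without the factor \<open>e\<^sub>i\<close> exhibits
  \<open>\<And>\<langle>insert i B\<rangle>\<close> as \<open>e\<^sub>i \<and> \<And>\<langle>B\<rangle> \<oplus> \<And>\<langle>B\<rangle>\<close>; multiplication by \<open>e\<^sub>i\<close> identifies \<open>\<And>\<langle>B\<rangle>\<close>, shifted
  by one degree, with the first summand, which is the kernel of \<open>e\<^sub>i \<mapsto> 0\<close>.  This sequence is carried
  to the cosets along the two isomorphisms (\<open>graded_short_exact_sequence_transport\<close>).
\<close>

section \<open>Transport of graded vector spaces along linear isomorphisms\<close>

text \<open>
  The target is an arbitrary record, not yet known to be a vector space.  Its zero element is
  then unrelated to its addition, which is why \<open>f \<zero> = \<zero>\<close> has to be asked for.
\<close>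

definition linear_isos ::
  "(complex, 'a, 'm) module_scheme \<Rightarrow> (complex, 'b, 'n) module_scheme \<Rightarrow> ('a \<Rightarrow> 'b) set" where
  "linear_isos M N =
     {f \<in> linear_maps M N. bij_betw f (carrier M) (carrier N) \<and> f \<zero>\<^bsub>M\<^esub> = \<zero>\<^bsub>N\<^esub>}"

lemma linear_isosD:
  assumes "f \<in> linear_isos M N"
  shows "\<And>x. x \<in> carrier M \<Longrightarrow> f x \<in> carrier N"
    and "\<And>x y. x \<in> carrier M \<Longrightarrow> y \<in> carrier M \<Longrightarrow> f (x \<oplus>\<^bsub>M\<^esub> y) = f x \<oplus>\<^bsub>N\<^esub> f y"
    and "\<And>c x. x \<in> carrier M \<Longrightarrow> f (c \<odot>\<^bsub>M\<^esub> x) = c \<odot>\<^bsub>N\<^esub> f x"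
    and "f \<zero>\<^bsub>M\<^esub> = \<zero>\<^bsub>N\<^esub>"
    and "inj_on f (carrier M)"
    and "carrier N = f ` carrier M"
  using assms by (auto simp: linear_isos_def linear_maps_def bij_betw_def)

lemma complex_field_simps:
  "carrier complex_field = UNIV"
  "(a :: complex) \<oplus>\<^bsub>complex_field\<^esub> b = a + b"
  "a \<otimes>\<^bsub>complex_field\<^esub> b = a * b"
  "\<one>\<^bsub>complex_field\<^esub> = (1 :: complex)"
  by (simp_all add: ring_of_type_algebra_def)

lemma complex_submoduleI:
  assumes "Module.module complex_field M" "H \<subseteq> carrier M" "\<zero>\<^bsub>M\<^esub> \<in> H"
    and "\<And>x y. x \<in> H \<Longrightarrow> y \<in> H \<Longrightarrow> x \<oplus>\<^bsub>M\<^esub> y \<in> H"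
    and smult: "\<And>c x. x \<in> H \<Longrightarrow> c \<odot>\<^bsub>M\<^esub> x \<in> H"
  shows "submodule H complex_field M"
proof -
  interpret Module.module complex_field M by fact
  have "\<ominus>\<^bsub>M\<^esub> x \<in> H" if "x \<in> H" for x
    using smult_l_minus[of "\<one>\<^bsub>complex_field\<^esub>" x]
      smult[OF that, of "\<ominus>\<^bsub>complex_field\<^esub> \<one>\<^bsub>complex_field\<^esub>"] that assms(2)
    by (auto simp: subset_iff)
  with assms show ?thesis by (intro submoduleI) auto
qed

lemma module_transport:
  assumes M: "Module.module complex_field M" and f: "f \<in> linear_isos M N"
  shows "Module.module complex_field N"
proof -
  interpret Module.module complex_field M by fact
  note fD = linear_isosD[OF f]
  note smult = smult_closed[unfolded complex_field_simps] smult_l_distr[unfolded complex_field_simps]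
    smult_r_distr[unfolded complex_field_simps] smult_assoc1[unfolded complex_field_simps]
    smult_one[unfolded complex_field_simps]
  show ?thesis
  proof (rule moduleI, unfold complex_field_simps)
    show "cring (complex_field)" by (rule cring_from_type_algebra)
    show "abelian_group N"
    proof (rule abelian_groupI, goal_cases)
      case (6 x)
      then obtain y where "y \<in> carrier M" "x = f y" by (auto simp: fD(6))
      then show ?case
        by (intro bexI[of _ "f (\<ominus>\<^bsub>M\<^esub> y)"])
          (simp_all add: fD(1) M.l_neg flip: fD(2,4))
    qed (auto simp: fD(6) M.a_ac simp flip: fD(2,4))
  qed (auto simp: fD(6) smult[simplified] simp flip: fD(2,3))
qed

lemma finsum_transport:
  assumes M: "abelian_group M" and N: "abelian_group N" and f: "f \<in> linear_isos M N"
    and "finite F" "g \<in> F \<rightarrow> carrier M"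
  shows "f (\<Oplus>\<^bsub>M\<^esub>p\<in>F. g p) = (\<Oplus>\<^bsub>N\<^esub>p\<in>F. f (g p))"
  using assms(4,5)
proof (induction F rule: finite_induct)
  case empty
  interpret M: abelian_group M by fact
  interpret N: abelian_group N by fact
  show ?case by (simp add: linear_isosD(4)[OF f])
next
  case (insert p F)
  interpret M: abelian_group M by fact
  interpret N: abelian_group N by fact
  have "(\<lambda>p. f (g p)) \<in> F \<rightarrow> carrier N" "f (g p) \<in> carrier N"
    using insert.prems by (auto intro: linear_isosD(1)[OF f])
  with insert show ?case by (simp add: linear_isosD(2)[OF f])
qed

text \<open>
  A decomposition of \<open>f x\<close> into components from the spaces \<open>f ` G p\<close> pulls back along \<open>f\<close>,
  component by component, to a decomposition of \<open>x\<close> with the same support; so uniqueness passes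
  from \<open>M\<close> to \<open>N\<close>.
\<close>

lemma graded_vector_space_transport:
  assumes G: "graded_vector_space M G" and f: "f \<in> linear_isos M N"
  shows "graded_vector_space N (\<lambda>p. f ` G p)"
proof -
  have modM: "Module.module complex_field M"
    and sub: "\<And>p. submodule (G p) complex_field M"
    using G by (auto simp: graded_vector_space_def)
  interpret M: Module.module complex_field M by fact
  have modN: "Module.module complex_field N" by (rule module_transport[OF modM f])
  interpret N: Module.module complex_field N by fact
  note fD = linear_isosD[OF f]
  have Gsub: "\<And>p x. x \<in> G p \<Longrightarrow> x \<in> carrier M"
    using M.submoduleE(1)[OF sub] by blast
  have zeroG: "\<zero>\<^bsub>M\<^esub> \<in> G p" for p
    using subgroup.one_closed[OF submodule.axioms(1)[OF sub[of p]]] by simp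
  have supp: "{p. f (g p) \<noteq> \<zero>\<^bsub>N\<^esub>} = {p. g p \<noteq> \<zero>\<^bsub>M\<^esub>}" if "\<And>p. g p \<in> G p" for g
    using inj_onD[OF fD(5), of _ "\<zero>\<^bsub>M\<^esub>"] Gsub[OF that] by (auto simp flip: fD(4))
  have sum: "(\<Oplus>\<^bsub>N\<^esub>p\<in>P. f (g p)) = f (\<Oplus>\<^bsub>M\<^esub>p\<in>P. g p)" if "\<And>p. g p \<in> G p" "finite P" for g P
    by (rule finsum_transport[symmetric])
      (use that f Gsub M.abelian_group_axioms N.abelian_group_axioms in auto)
  show ?thesis unfolding graded_vector_space_def
  proof (intro conjI allI ballI)
    show "submodule (f ` G p) complex_field N" for p
    proof (rule complex_submoduleI[OF modN])
      show "f ` G p \<subseteq> carrier N" using Gsub fD(1) by auto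
      show "\<zero>\<^bsub>N\<^esub> \<in> f ` G p" using zeroG by (auto simp flip: fD(4))
    qed (use Gsub M.submoduleE(4,5)[OF sub[of p]] in
        \<open>auto simp: complex_field_simps simp flip: fD(2,3)\<close>)
  next
    fix y assume "y \<in> carrier N"
    then obtain x where x: "x \<in> carrier M" "y = f x" by (auto simp: fD(6))
    let ?P = "\<lambda>g. (\<forall>p. g p \<in> G p) \<and> finite {p. g p \<noteq> \<zero>\<^bsub>M\<^esub>} \<and>
      x = (\<Oplus>\<^bsub>M\<^esub>p\<in>{p. g p \<noteq> \<zero>\<^bsub>M\<^esub>}. g p)"
    have "\<exists>!g. ?P g" using G x(1) by (simp add: graded_vector_space_def)
    then obtain g where g: "?P g" and uniq: "\<And>h. ?P h \<Longrightarrow> h = g" by blast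
    show "\<exists>!g. (\<forall>p. g p \<in> f ` G p) \<and> finite {p. g p \<noteq> \<zero>\<^bsub>N\<^esub>} \<and>
      y = (\<Oplus>\<^bsub>N\<^esub>p\<in>{p. g p \<noteq> \<zero>\<^bsub>N\<^esub>}. g p)"
    proof (rule ex1I[of _ "\<lambda>p. f (g p)"], goal_cases)
      case 1
      show ?case using g x(2) supp[of g] sum[of g] by auto
    next
      case (2 k)
      then have "\<forall>p. \<exists>h. h \<in> G p \<and> k p = f h" by blast
      then obtain h where h: "\<And>p. h p \<in> G p" and k: "k = (\<lambda>p. f (h p))" by metis
      have fin: "finite {p. h p \<noteq> \<zero>\<^bsub>M\<^esub>}" using 2 supp[of h] h by (simp add: k)
      have "f x = f (\<Oplus>\<^bsub>M\<^esub>p\<in>{p. h p \<noteq> \<zero>\<^bsub>M\<^esub>}. h p)"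
        using 2 x(2) supp[of h] h sum[OF h fin] by (simp add: k)
      then have "x = (\<Oplus>\<^bsub>M\<^esub>p\<in>{p. h p \<noteq> \<zero>\<^bsub>M\<^esub>}. h p)"
        by (rule inj_onD[OF fD(5) _ x(1)]) (use h Gsub in \<open>auto intro: M.M.finsum_closed\<close>)
      with fin h have "h = g" by (intro uniq) simp
      then show ?case by (simp add: k)
    qed
  qed (rule modN)
qed

lemma graded_short_exact_sequence_transport:
  assumes S: "graded_short_exact_sequence L F M G N H a b"
    and f: "f \<in> linear_isos M M'" and h: "h \<in> linear_isos N N'"
  shows "graded_short_exact_sequence L F M' (\<lambda>p. f ` G p) N' (\<lambda>p. h ` H p)
    (\<lambda>x. f (a x)) (\<lambda>y. h (b (inv_into (carrier M) f y)))"
proof -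
  note S' = S[unfolded graded_short_exact_sequence_def]
  note S = S[unfolded graded_short_exact_sequence_def graded_linear_maps_def linear_maps_def]
  note fD = linear_isosD[OF f] and hD = linear_isosD[OF h]
  let ?inv = "inv_into (carrier M) f"
  have inv: "?inv (f x) = x" if "x \<in> carrier M" for x
    using fD(5) that by simp
  have aL: "\<And>x. x \<in> carrier L \<Longrightarrow> a x \<in> carrier M" and bM: "\<And>x. x \<in> carrier M \<Longrightarrow> b x \<in> carrier N"
    using S by auto
  have MN: "Module.module complex_field M" "Module.module complex_field N"
    using S by (auto simp: graded_vector_space_def)
  interpret M: Module.module complex_field M by fact
  interpret N: Module.module complex_field N by fact
  have Gsub: "\<And>p x. x \<in> G p \<Longrightarrow> x \<in> carrier M"
    using S M.submoduleE(1) by (fastforce simp: graded_vector_space_def)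
  have Msmult: "\<And>c x. x \<in> carrier M \<Longrightarrow> c \<odot>\<^bsub>M\<^esub> x \<in> carrier M"
    using M.smult_closed by (simp add: complex_field_simps)
  have ker: "h (b x) = \<zero>\<^bsub>N'\<^esub> \<longleftrightarrow> b x = \<zero>\<^bsub>N\<^esub>" if "x \<in> carrier M" for x
    using inj_onD[OF hD(5), of "b x" "\<zero>\<^bsub>N\<^esub>"] bM[OF that] by (auto simp: hD(4))
  have a: "a \<in> linear_maps L M" "\<And>p x. x \<in> F p \<Longrightarrow> a x \<in> G p"
    and b: "b \<in> linear_maps M N" "\<And>p x. x \<in> G p \<Longrightarrow> b x \<in> H p"
    using S' by (auto simp: graded_linear_maps_def image_subset_iff)
  show ?thesis
    unfolding graded_short_exact_sequence_def
  proof (intro conjI)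
    show "graded_vector_space L F" using S by blast
    show "graded_vector_space M' (\<lambda>p. f ` G p)"
      by (rule graded_vector_space_transport[OF _ f]) (use S in blast)
    show "graded_vector_space N' (\<lambda>p. h ` H p)"
      by (rule graded_vector_space_transport[OF _ h]) (use S in blast)
    show "(\<lambda>x. f (a x)) \<in> graded_linear_maps L F M' (\<lambda>p. f ` G p)"
      using a unfolding graded_linear_maps_def linear_maps_def by (auto simp: fD(1-3) aL)
    show "(\<lambda>y. h (b (?inv y))) \<in> graded_linear_maps M' (\<lambda>p. f ` G p) N' (\<lambda>p. h ` H p)"
      using b unfolding graded_linear_maps_def linear_maps_def
      by (auto simp: fD(6) inv hD(1-3) bM Gsub Msmult simp flip: fD(2,3))
    show "inj_on (\<lambda>x. f (a x)) (carrier L)"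
      using S fD(5) aL by (auto simp: inj_on_def)
    have "a ` carrier L = {x \<in> carrier M. b x = \<zero>\<^bsub>N\<^esub>}" using S by (simp add: a_kernel_def')
    then have "f ` a ` carrier L = f ` {x \<in> carrier M. b x = \<zero>\<^bsub>N\<^esub>}" by simp
    then show "(\<lambda>x. f (a x)) ` carrier L = a_kernel M' N' (\<lambda>y. h (b (?inv y)))"
      by (auto simp: a_kernel_def' fD(6) inv ker hD(4) image_image)
    have "(\<lambda>y. h (b (?inv y))) ` carrier M' = h ` b ` carrier M"
      by (auto simp: fD(6) inv image_image)
    then show "(\<lambda>y. h (b (?inv y))) ` carrier M' = carrier N'"
      using S hD(6) by simp
  qed
qed


section \<open>The deletion sequence of an exterior algebra\<close>

lemma finsum_exterior:
  assumes "finite F" "g \<in> F \<rightarrow> carrier (exterior A)"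
  shows "(\<Oplus>\<^bsub>exterior A\<^esub>p\<in>F. g p) = (\<lambda>S. \<Sum>p\<in>F. g p S)"
  using assms
proof (induction F rule: finite_induct)
  case empty
  interpret abelian_group "exterior A" by (rule exterior_abelian_group)
  show ?case by simp
next
  case (insert p F)
  interpret abelian_group "exterior A" by (rule exterior_abelian_group)
  show ?case using insert by simp
qed

text \<open>
  The degree is an arbitrary function \<open>d\<close> of the monomials so as to cover both \<open>card\<close> and the shifted
  degree \<open>Suc \<circ> card\<close>.
\<close>

lemma exterior_graded_vector_space:
  "graded_vector_space (exterior A) (\<lambda>p. {a \<in> carrier (exterior A). \<forall>S. a S \<noteq> 0 \<longrightarrow> d S = p})"
  unfolding graded_vector_space_def
proof (intro conjI allI ballI)
  interpret abelian_group "exterior A" by (rule exterior_abelian_group)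
  show mod: "Module.module complex_field (exterior A)" by (rule exterior_module)
  show "submodule {a \<in> carrier (exterior A). \<forall>S. a S \<noteq> 0 \<longrightarrow> d S = p} complex_field (exterior A)" for p
  proof (rule complex_submoduleI[OF mod], goal_cases)
    case 2
    show ?case using zero_closed by auto
  next
    case (3 x y)
    then have "d S = p" if "x S + y S \<noteq> 0" for S using that by (cases "x S = 0") auto
    with 3 show ?case by (auto simp: exterior_add_closed)
  qed (auto simp: exterior_smult_closed)
  fix x assume x: "x \<in> carrier (exterior A)"
  \<comment> \<open>The component of \<open>x\<close> in degree \<open>p\<close>.\<close>
  define g where "g p S = (if d S = p then x S else 0)" for p S
  have finx: "finite {S. x S \<noteq> 0}" using x by (simp add: exterior_carrier)
  have gcar: "g p \<in> carrier (exterior A)" for p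
  proof -
    have "finite {S. g p S \<noteq> 0}"
      by (rule finite_subset[OF _ finx]) (auto simp: g_def)
    with x show ?thesis by (auto simp: exterior_carrier g_def)
  qed
  have fing: "finite {p. g p \<noteq> (\<lambda>S. 0)}"
    by (rule finite_subset[of _ "d ` {S. x S \<noteq> 0}"]) (use finx in \<open>auto simp: g_def fun_eq_iff\<close>)
  have "x S = (\<Sum>p\<in>{p. g p \<noteq> (\<lambda>S. 0)}. g p S)" for S
  proof (cases "x S = 0")
    case False
    then have "d S \<in> {p. g p \<noteq> (\<lambda>S. 0)}" by (auto simp: g_def fun_eq_iff)
    then show ?thesis using fing by (simp add: g_def)
  qed (simp add: g_def cong: if_cong)
  then have xsum: "x = (\<Oplus>\<^bsub>exterior A\<^esub>p\<in>{p. g p \<noteq> (\<lambda>S. 0)}. g p)"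
    using finsum_exterior[OF fing, of g A] gcar by auto
  show "\<exists>!g. (\<forall>p. g p \<in> {a \<in> carrier (exterior A). \<forall>S. a S \<noteq> 0 \<longrightarrow> d S = p}) \<and>
      finite {p. g p \<noteq> \<zero>\<^bsub>exterior A\<^esub>} \<and> x = (\<Oplus>\<^bsub>exterior A\<^esub>p\<in>{p. g p \<noteq> \<zero>\<^bsub>exterior A\<^esub>}. g p)"
  proof (rule ex1I[of _ g], goal_cases)
    case 1
    show ?case using xsum fing gcar by (simp add: g_def)
  next
    case (2 k)
    let ?P = "{p. k p \<noteq> (\<lambda>S. 0)}"
    have deg: "k p S = 0" if "d S \<noteq> p" for p S using 2 that by auto
    have xS: "x S = (\<Sum>p\<in>?P. k p S)" for S
      using 2 finsum_exterior[of ?P k A] by (auto dest: fun_cong[of x _ S])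
    \<comment> \<open>Of all components, only that in degree \<open>d S\<close> can contribute to the coefficient of \<open>e\<^sub>S\<close>.\<close>
    have "x S = k (d S) S" for S
    proof (cases "d S \<in> ?P")
      case True
      have "(\<Sum>p\<in>?P. k p S) = (\<Sum>p\<in>?P. if p = d S then k p S else 0)"
        by (rule sum.cong) (auto simp: deg)
      with 2 True show ?thesis unfolding xS by simp
    next
      case False
      then have "(\<Sum>p\<in>?P. k p S) = 0"
        by (intro sum.neutral ballI deg) auto
      with False show ?thesis unfolding xS by simp
    qed
    then show ?case by (auto simp: g_def fun_eq_iff deg)
  qed
qed

lemma wedge_gen:
  "wedge (gen i) x S =
    (if i \<in> S \<and> finite S then shuffle_sign {i} (S - {i}) * x (S - {i}) else 0)"
proof (cases "i \<in> S \<and> finite S")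
  case True
  have "wedge (gen i) x S = (\<Sum>T\<in>{{i}}. shuffle_sign T (S - T) * gen i T * x (S - T))"
    unfolding wedge_def
    by (rule sum.mono_neutral_right) (use True in \<open>auto simp: gen_def basis_elt_def\<close>)
  with True show ?thesis by (simp add: gen_def basis_elt_def)
next
  case False
  have "wedge (gen i) x S = 0"
  proof (cases "finite S")
    case True
    with False show ?thesis
      unfolding wedge_def by (intro sum.neutral) (auto simp: gen_def basis_elt_def)
  qed (simp add: wedge_infinite)
  with False show ?thesis by auto
qed

text \<open>The algebra map that sends \<open>e\<^sub>j\<close> to \<open>0\<close> for \<open>j \<notin> B\<close> and fixes the other generators.\<close>

definition restrict_generators :: "nat set \<Rightarrow> (nat set \<Rightarrow> complex) \<Rightarrow> nat set \<Rightarrow> complex" where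
  "restrict_generators B a S = (if S \<subseteq> B then a S else 0)"

lemma restrict_generators_closed:
  assumes "a \<in> carrier (exterior A)"
  shows "restrict_generators B a \<in> carrier (exterior B)"
proof -
  have "finite {S. restrict_generators B a S \<noteq> 0}"
    by (rule finite_subset[of _ "{S. a S \<noteq> 0}"])
      (use assms in \<open>auto simp: exterior_carrier restrict_generators_def\<close>)
  with assms show ?thesis by (auto simp: exterior_carrier restrict_generators_def)
qed

text \<open>
  In the product, a monomial \<open>e\<^sub>S\<close> collects the ways of splitting \<open>S\<close> into two factors, and \<open>S\<close> lies
  in \<open>B\<close> exactly if both parts do.
\<close>

lemma restrict_generators_wedge:
  "restrict_generators B (wedge a b) = wedge (restrict_generators B a) (restrict_generators B b)"
proof
  fix S
  show "restrict_generators B (wedge a b) S = wedge (restrict_generators B a) (restrict_generators B b) S"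
  proof (cases "S \<subseteq> B")
    case True
    then show ?thesis
      by (simp add: restrict_generators_def wedge_def) (rule sum.cong, auto)
  next
    case False
    then have "T \<subseteq> B \<longrightarrow> \<not> S - T \<subseteq> B" for T by blast
    with False show ?thesis
      by (auto simp: restrict_generators_def wedge_def intro!: sum.neutral)
  qed
qed

lemma restrict_generators_algebra_hom:
  "restrict_generators B \<in> algebra_homs (exterior A) (exterior B)"
proof -
  have "restrict_generators B (basis_elt {}) = basis_elt {}"
    by (auto simp: restrict_generators_def basis_elt_def)
  then show ?thesis
    by (auto simp: algebra_homs_def ring_hom_def linear_maps_def restrict_generators_closed
        restrict_generators_wedge, auto simp: restrict_generators_def)
qed

lemma restrict_generators_gen:
  "restrict_generators B (gen j) = (if j \<in> B then gen j else (\<lambda>S. 0))"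
  by (auto simp: restrict_generators_def gen_def basis_elt_def)

text \<open>
  A preimage under \<open>e\<^sub>i \<and> -\<close> of an element of the kernel is obtained by striking out \<open>e\<^sub>i\<close> in each
  monomial, with the sign that moves \<open>e\<^sub>i\<close> to the front.
\<close>

lemma exterior_deletion_exact:
  assumes "i \<notin> B"
  shows "wedge (gen i) ` carrier (exterior B) =
    a_kernel (exterior (insert i B)) (exterior B) (restrict_generators B)"
proof (intro equalityI subsetI)
  fix y assume "y \<in> wedge (gen i) ` carrier (exterior B)"
  then obtain x where x: "x \<in> carrier (exterior B)" "y = wedge (gen i) x" by blast
  have "gen i \<in> carrier (exterior (insert i B))" by (auto simp: gen_def intro: basis_elt_closed)
  moreover have "x \<in> carrier (exterior (insert i B))" using x by (auto simp: exterior_carrier)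
  ultimately have "y \<in> carrier (exterior (insert i B))" using x by (simp add: wedge_closed)
  moreover have "restrict_generators B y = (\<lambda>S. 0)"
    using assms by (auto simp: x restrict_generators_def wedge_gen fun_eq_iff)
  ultimately show "y \<in> a_kernel (exterior (insert i B)) (exterior B) (restrict_generators B)"
    by (simp add: a_kernel_def')
next
  fix y assume "y \<in> a_kernel (exterior (insert i B)) (exterior B) (restrict_generators B)"
  then have y: "y \<in> carrier (exterior (insert i B))" and "restrict_generators B y = (\<lambda>S. 0)"
    by (auto simp: a_kernel_def')
  then have y0: "y S = 0" if "S \<subseteq> B" for S
    using that by (metis restrict_generators_def)
  have ycar: "finite S \<and> S \<subseteq> insert i B" if "y S \<noteq> 0" for S
    using y that by (simp add: exterior_carrier)
  define x where "x T = (if i \<in> T then 0 else shuffle_sign {i} T * y (insert i T))" for T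
  have xnz: "i \<notin> T" "y (insert i T) \<noteq> 0" if "x T \<noteq> 0" for T
    using that by (auto simp: x_def split: if_splits)
  have "T \<in> (\<lambda>S. S - {i}) ` {S. y S \<noteq> 0}" if "x T \<noteq> 0" for T
    by (rule image_eqI[of _ _ "insert i T"]) (use xnz[OF that] in auto)
  then have "{T. x T \<noteq> 0} \<subseteq> (\<lambda>S. S - {i}) ` {S. y S \<noteq> 0}" by blast
  moreover have "finite {S. y S \<noteq> 0}" using y by (simp add: exterior_carrier)
  ultimately have "finite {T. x T \<noteq> 0}" by (meson finite_imageI finite_subset)
  moreover have "finite T \<and> T \<subseteq> B" if "x T \<noteq> 0" for T
  proof -
    have "finite (insert i T) \<and> insert i T \<subseteq> insert i B"
      using xnz(2)[OF that] by (rule ycar)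
    with xnz(1)[OF that] show ?thesis by auto
  qed
  ultimately have "x \<in> carrier (exterior B)" by (simp add: exterior_carrier)
  moreover have "y S = wedge (gen i) x S" for S
  proof (cases "y S = 0")
    case True
    then show ?thesis by (auto simp: wedge_gen x_def insert_absorb)
  next
    case False
    then have "finite S" "S \<subseteq> insert i B" "\<not> S \<subseteq> B" using y y0 by (auto simp: exterior_carrier)
    then have "i \<in> S" by auto
    with \<open>finite S\<close> show ?thesis by (simp add: wedge_gen x_def insert_absorb flip: mult.assoc)
  qed
  ultimately show "y \<in> wedge (gen i) ` carrier (exterior B)" by blast
qed

lemma exterior_deletion_sequence:
  assumes "i \<notin> B"
  shows "graded_short_exact_sequence
    (exterior B) (shift_grading (exterior B) (exterior_degree B))
    (exterior (insert i B)) (exterior_degree (insert i B))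
    (exterior B) (exterior_degree B) (wedge (gen i)) (restrict_generators B)"
proof -
  have deg: "graded_vector_space (exterior A) (exterior_degree A)" for A
    using exterior_graded_vector_space[of A card] by (simp add: exterior_degree_def[abs_def])
  interpret abelian_group "exterior B" by (rule exterior_abelian_group)
  have shift: "shift_grading (exterior B) (exterior_degree B) =
      (\<lambda>p. {a \<in> carrier (exterior B). \<forall>S. a S \<noteq> 0 \<longrightarrow> Suc (card S) = p})"
    using zero_closed
    by (auto simp: shift_grading_def exterior_degree_def fun_eq_iff split: nat.splits)
  have img: "wedge (gen i) ` carrier (exterior B) =
      a_kernel (exterior (insert i B)) (exterior B) (restrict_generators B)"
    using assms by (rule exterior_deletion_exact)
  have closed: "wedge (gen i) x \<in> carrier (exterior (insert i B))" if "x \<in> carrier (exterior B)" for x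
    using img that by (auto simp: a_kernel_def')
  show ?thesis unfolding graded_short_exact_sequence_def
  proof (intro conjI deg img)
    show "graded_vector_space (exterior B) (shift_grading (exterior B) (exterior_degree B))"
      unfolding shift by (rule exterior_graded_vector_space)
    show "wedge (gen i) \<in> graded_linear_maps (exterior B)
        (shift_grading (exterior B) (exterior_degree B))
        (exterior (insert i B)) (exterior_degree (insert i B))"
      unfolding shift graded_linear_maps_def linear_maps_def
    proof (intro CollectI conjI allI ballI)
      fix p
      show "wedge (gen i) ` {a \<in> carrier (exterior B). \<forall>S. a S \<noteq> 0 \<longrightarrow> Suc (card S) = p}
          \<subseteq> exterior_degree (insert i B) p"
      proof (rule image_subsetI)
        fix x assume x: "x \<in> {a \<in> carrier (exterior B). \<forall>S. a S \<noteq> 0 \<longrightarrow> Suc (card S) = p}"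
        have "card S = p" if "wedge (gen i) x S \<noteq> 0" for S
        proof -
          have S: "i \<in> S" "finite S" "x (S - {i}) \<noteq> 0"
            using that by (auto simp: wedge_gen split: if_splits)
          then have "Suc (card (S - {i})) = p" using x by blast
          with S show ?thesis by (metis card.remove)
        qed
        with x closed show "wedge (gen i) x \<in> exterior_degree (insert i B) p"
          by (simp add: exterior_degree_def)
      qed
    qed (auto simp: closed wedge_gen fun_eq_iff algebra_simps)
    show "restrict_generators B \<in> graded_linear_maps
        (exterior (insert i B)) (exterior_degree (insert i B)) (exterior B) (exterior_degree B)"
      using restrict_generators_algebra_hom[of B "insert i B"]
      by (auto simp: graded_linear_maps_def algebra_homs_def exterior_degree_def
          restrict_generators_closed restrict_generators_def split: if_splits)
    show "inj_on (wedge (gen i)) (carrier (exterior B))"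
    proof (rule inj_onI)
      fix x y assume xy: "x \<in> carrier (exterior B)" "y \<in> carrier (exterior B)"
        and eq: "wedge (gen i) x = wedge (gen i) y"
      show "x = y"
      proof
        fix T
        show "x T = y T"
        proof (cases "finite T \<and> T \<subseteq> B")
          case True
          with assms have "insert i T - {i} = T" by auto
          then have "shuffle_sign {i} T * x T = shuffle_sign {i} T * y T"
            using fun_cong[OF eq, of "insert i T"] True by (simp add: wedge_gen)
          then show ?thesis by (metis sign_cancel shuffle_sign_mult_self)
        next
          case False
          with xy have "x T = 0" "y T = 0" unfolding exterior_carrier by blast+
          then show ?thesis by simp
        qed
      qed
    qed
    have "x \<in> restrict_generators B ` carrier (exterior (insert i B))"
      if x: "x \<in> carrier (exterior B)" for x
    proof
      show "x = restrict_generators B x"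
        using x by (auto simp: restrict_generators_def exterior_carrier fun_eq_iff)
      show "x \<in> carrier (exterior (insert i B))"
        using x unfolding exterior_carrier by blast
    qed
    then show "restrict_generators B ` carrier (exterior (insert i B)) = carrier (exterior B)"
      by (auto intro: restrict_generators_closed)
  qed
qed


section \<open>Arrangements without multiple points\<close>

lemma OS_ideal_no_triple_points:
  assumes "\<And>P. card (curves_through \<gamma> A P) < 3"
  shows "OS_ideal \<gamma> A = {\<lambda>S. 0}"
proof -
  interpret ring "exterior A" by (rule exterior_ring)
  have "OS_ideal \<gamma> A = Idl\<^bsub>exterior A\<^esub> {}"
    unfolding OS_ideal_def
    by (rule arg_cong[where f = "genideal _"]) (use assms in \<open>auto simp: not_le\<close>)
  moreover have "Idl\<^bsub>exterior A\<^esub> {} \<subseteq> {\<zero>\<^bsub>exterior A\<^esub>}"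
    by (rule genideal_minimal[OF zeroideal]) simp
  moreover have "\<zero>\<^bsub>exterior A\<^esub> \<in> Idl\<^bsub>exterior A\<^esub> {}"
    using genideal_ideal[of "{}"]
    by (intro additive_subgroup.zero_closed ideal.axioms(1)) simp
  ultimately show ?thesis by auto
qed

text \<open>The cosets of the zero ideal are the singletons, and their operations are those of the elements.\<close>

lemma OS_class_linear_iso:
  assumes "\<And>P. card (curves_through \<gamma> A P) < 3"
  shows "OS_class \<gamma> A \<in> linear_isos (exterior A) (OS \<gamma> A)"
proof -
  note I = OS_ideal_no_triple_points[OF assms]
  have cls: "{\<lambda>S. 0} +>\<^bsub>exterior A\<^esub> x = {x}" for x :: "nat set \<Rightarrow> complex"
    by (simp add: a_r_coset_def')
  show ?thesis
    unfolding linear_isos_def linear_maps_def bij_betw_def OS_def OS_class_def quotient_algebra_def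
      I cls
    by (auto simp: ring.defs module.defs FactRing_def A_RCOSETS_def' set_add_def' cls inj_on_def)
qed

text \<open>
  Two curves other than \<open>\<gamma>\<^sub>k\<close> have no point in common, so at most one of them can join \<open>\<gamma>\<^sub>k\<close> at
  \<open>P\<close>.
\<close>

lemma curves_through_bounded:
  assumes "\<And>i j. i \<in> A - {k} \<Longrightarrow> j \<in> A - {k} \<Longrightarrow> i \<noteq> j \<Longrightarrow> curve (\<gamma> i) \<inter> curve (\<gamma> j) = {}"
  shows "card (curves_through \<gamma> A P) < 3"
proof -
  have "curves_through \<gamma> A P - {k} \<subseteq> {j}" if "j \<in> curves_through \<gamma> A P - {k}" for j
    using assms[of _ j] that by (auto simp: curves_through_def)
  then obtain j where "curves_through \<gamma> A P \<subseteq> {k, j}" by blast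
  then have "card (curves_through \<gamma> A P) \<le> card {k, j}" by (intro card_mono) auto
  \<comment> \<open>The cardinality is 1 if the curve \<open>j\<close> chosen above happens to be \<open>k\<close>.\<close>
  also have "\<dots> \<le> 2" by (simp add: card_insert_if)
  finally show ?thesis by simp
qed

lemma restricted_labels_disjoint:
  assumes meet: "\<And>j. j \<in> {1..v} \<Longrightarrow> curve (\<gamma> 0) \<inter> curve (\<gamma> j) \<noteq> {}"
    and disj: "\<And>i j. i \<in> {1..v} \<Longrightarrow> j \<in> {1..v} \<Longrightarrow> i \<noteq> j \<Longrightarrow> curve (\<gamma> i) \<inter> curve (\<gamma> j) = {}"
  shows "restricted_labels \<gamma> v = {1..v}"
proof -
  have label: "point_label \<gamma> v P = j" if "j \<in> {1..v}" "P \<in> curve (\<gamma> j)" for P j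
  proof -
    have "curves_through \<gamma> {1..v} P = {j}"
      using that disj unfolding curves_through_def by blast
    then show ?thesis by (simp add: point_label_def)
  qed
  show ?thesis
  proof (intro equalityI subsetI)
    fix j assume j: "j \<in> {1..v}"
    with meet obtain P where "P \<in> curve (\<gamma> 0)" "P \<in> curve (\<gamma> j)" by blast
    with j label[of j P] show "j \<in> restricted_labels \<gamma> v"
      unfolding restricted_labels_def restricted_points_def by blast
  qed (auto simp: restricted_labels_def restricted_points_def label)
qed

theorem theorem8p24:
  fixes \<gamma> :: "nat \<Rightarrow> complex poly poly" and v0 :: nat
  assumes "curve_arrangement \<gamma> {0..v0}"
    and "\<And>j. j \<in> {1..v0} \<Longrightarrow>
      \<exists>P. curve (\<gamma> 0) \<inter> curve (\<gamma> j) = {P} \<and> ordinary_double_point \<gamma> {0..v0} P"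
    and "\<And>i j. i \<in> {1..v0} \<Longrightarrow> j \<in> {1..v0} \<Longrightarrow> i \<noteq> j \<Longrightarrow> curve (\<gamma> i) \<inter> curve (\<gamma> j) = {}"
  shows "\<exists>\<iota> \<pi>.
    graded_short_exact_sequence
      (exterior (restricted_labels \<gamma> v0))
        (shift_grading (exterior (restricted_labels \<gamma> v0)) (exterior_degree (restricted_labels \<gamma> v0)))
      (OS \<gamma> {0..v0}) (OS_degree \<gamma> {0..v0})
      (OS \<gamma> {1..v0}) (OS_degree \<gamma> {1..v0}) \<iota> \<pi> \<and>
    (\<exists>\<phi> \<in> algebra_homs (exterior {0..v0}) (exterior {1..v0}).
      \<phi> (gen 0) = \<zero>\<^bsub>exterior {1..v0}\<^esub> \<and> (\<forall>j\<in>{1..v0}. \<phi> (gen j) = gen j) \<and>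
      (\<forall>x\<in>carrier (exterior {0..v0}). \<pi> (OS_class \<gamma> {0..v0} x) = OS_class \<gamma> {1..v0} (\<phi> x))) \<and>
    (\<forall>js. sorted_wrt (<) js \<and> set js \<subseteq> {1..v0} \<longrightarrow>
      \<iota> (monomial js) = OS_class \<gamma> {0..v0} (monomial (0 # js)))"
proof -
  let ?c0 = "OS_class \<gamma> {0..v0}" and ?c1 = "OS_class \<gamma> {1..v0}"
  let ?\<phi> = "restrict_generators {1..v0}"
  let ?\<iota> = "\<lambda>x. ?c0 (wedge (gen 0) x)"
  let ?\<pi> = "\<lambda>y. ?c1 (?\<phi> (inv_into (carrier (exterior {0..v0})) ?c0 y))"
  have ins: "insert 0 {1..v0} = {0..v0}" by auto
  have labels: "restricted_labels \<gamma> v0 = {1..v0}"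
  proof (rule restricted_labels_disjoint)
    fix j assume "j \<in> {1..v0}"
    from assms(2)[OF this] show "curve (\<gamma> 0) \<inter> curve (\<gamma> j) \<noteq> {}" by auto
  qed (use assms(3) in auto)
  have iso0: "?c0 \<in> linear_isos (exterior {0..v0}) (OS \<gamma> {0..v0})"
    by (intro OS_class_linear_iso curves_through_bounded[where k = 0]) (use assms(3) in auto)
  have iso1: "?c1 \<in> linear_isos (exterior {1..v0}) (OS \<gamma> {1..v0})"
    by (intro OS_class_linear_iso curves_through_bounded[where k = 0]) (use assms(3) in auto)
  have "graded_short_exact_sequence
      (exterior {1..v0}) (shift_grading (exterior {1..v0}) (exterior_degree {1..v0}))
      (OS \<gamma> {0..v0}) (OS_degree \<gamma> {0..v0}) (OS \<gamma> {1..v0}) (OS_degree \<gamma> {1..v0}) ?\<iota> ?\<pi>"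
    using graded_short_exact_sequence_transport
      [OF exterior_deletion_sequence[of 0 "{1..v0}", unfolded ins] iso0 iso1]
    by (simp add: OS_degree_def[abs_def])
  moreover have "?\<pi> (?c0 x) = ?c1 (?\<phi> x)" if "x \<in> carrier (exterior {0..v0})" for x
    using that linear_isosD(5)[OF iso0] by simp
  moreover have "?\<iota> (monomial js) = ?c0 (monomial (0 # js))" for js
    by (simp add: monomial_def)
  ultimately show ?thesis
    unfolding labels
    by (intro exI[of _ ?\<iota>] exI[of _ ?\<pi>] conjI bexI[of _ ?\<phi>] restrict_generators_algebra_hom)
      (simp_all add: restrict_generators_gen)
qed

end
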